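(* Let $D=\{x,y,z\}$ and let $\mathrm{PAULI}\subseteq D^6$ be the relation consisting of the five tuples $(x,x,z,x,z,x)$, $(x,x,x,y,x,y)$, $(y,z,x,y,y,z)$, $(y,y,y,x,y,x)$, $(z,y,y,z,x,y)$. Then $\mathrm{PAULI}$ admits a group embedding into a (finite, non-Abelian) group — in particular it admits a Mal'tsev embedding — but there is no Abelian group $G$ (finite or infinite) into which $\mathrm{PAULI}$ has a group embedding.
   Context: A relation $P\subseteq D^r$ has a group embedding into a group $G$ if there is an injective map $\sigma:D\to G$ and a coset $C$ of a subgroup of $G^r$ (with componentwise group operation) such that $C\cap \sigma(D)^r = \sigma(P)$, where $\sigma$ is applied componentwise. It is an Abelian group embedding if $G$ is Abelian. $P$ admits a Mal'tsev embedding if there are a set $E$, an injective map $\sigma:D\to E$, a relation $Q\subseteq E^r$ with $Q\cap\sigma(D)^r=\sigma(P)$, and a map $\varphi:E^3\to E$ with $\varphi(a,a,b)=\varphi(b,a,a)=b$ for all $a,b\in E$ such that applying $\varphi$ componentwise to any three tuples of $Q$ gives a tuple of $Q$. *)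

theory Defs
  imports "HOL-Algebra.Product_Groups" "HOL-Algebra.Left_Coset"
begin

text \<open>An \<open>r\<close>-tuple over \<open>D\<close> is an element of \<open>{..<r} \<rightarrow>\<^sub>E D\<close>, i.e. a function on the indices
  \<open>0, \<dots>, r - 1\<close> that is \<open>undefined\<close> elsewhere; this is the tuple type of
  \<^const>\<open>product_group\<close>. A map \<open>\<sigma>\<close> acts componentwise by \<open>compose {..<r} \<sigma>\<close>.\<close>

definition tuples :: "nat \<Rightarrow> 'a set \<Rightarrow> (nat \<Rightarrow> 'a) set"
  where "tuples r D = ({..<r} \<rightarrow>\<^sub>E D)"

definition tuple_of_list :: "'a list \<Rightarrow> nat \<Rightarrow> 'a"
  where "tuple_of_list xs = (\<lambda>i\<in>{..<length xs}. xs ! i)"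

definition power_group :: "('g, 'm) monoid_scheme \<Rightarrow> nat \<Rightarrow> (nat \<Rightarrow> 'g) monoid"
  where "power_group G r = product_group {..<r} (\<lambda>_. G)"

text \<open>A coset may be a left or a right coset.\<close>

definition group_embedding ::
  "'a set \<Rightarrow> nat \<Rightarrow> (nat \<Rightarrow> 'a) set \<Rightarrow> ('g, 'm) monoid_scheme \<Rightarrow> bool"
  where "group_embedding D r P G \<longleftrightarrow>
    (\<exists>\<sigma> H C. \<sigma> \<in> D \<rightarrow> carrier G \<and> inj_on \<sigma> D \<and>
       subgroup H (power_group G r) \<and>
       C \<in> (lcosets\<^bsub>power_group G r\<^esub> H) \<union> (rcosets\<^bsub>power_group G r\<^esub> H) \<and>
       C \<inter> tuples r (\<sigma> ` D) = compose {..<r} \<sigma> ` P)"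

definition maltsev_on :: "'e set \<Rightarrow> ('e \<Rightarrow> 'e \<Rightarrow> 'e \<Rightarrow> 'e) \<Rightarrow> bool"
  where "maltsev_on E m \<longleftrightarrow>
    (\<forall>a\<in>E. \<forall>b\<in>E. \<forall>c\<in>E. m a b c \<in> E) \<and>
    (\<forall>a\<in>E. \<forall>b\<in>E. m a a b = b \<and> m b a a = b)"

definition preserves ::
  "('e \<Rightarrow> 'e \<Rightarrow> 'e \<Rightarrow> 'e) \<Rightarrow> nat \<Rightarrow> (nat \<Rightarrow> 'e) set \<Rightarrow> bool"
  where "preserves m r Q \<longleftrightarrow>
    (\<forall>s\<in>Q. \<forall>t\<in>Q. \<forall>u\<in>Q. (\<lambda>i\<in>{..<r}. m (s i) (t i) (u i)) \<in> Q)"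

definition maltsev_embedding ::
  "'a set \<Rightarrow> nat \<Rightarrow> (nat \<Rightarrow> 'a) set \<Rightarrow> 'e set \<Rightarrow> bool"
  where "maltsev_embedding D r P E \<longleftrightarrow>
    (\<exists>\<sigma> Q m. \<sigma> \<in> D \<rightarrow> E \<and> inj_on \<sigma> D \<and>
       Q \<subseteq> tuples r E \<and> Q \<inter> tuples r (\<sigma> ` D) = compose {..<r} \<sigma> ` P \<and>
       maltsev_on E m \<and> preserves m r Q)"

datatype letter = dx | dy | dz

definition pauli_dom :: "letter set"
  where "pauli_dom = {dx, dy, dz}"

definition PAULI :: "(nat \<Rightarrow> letter) set"
  where "PAULI = tuple_of_list `
    {[dx, dx, dz, dx, dz, dx],
     [dx, dx, dx, dy, dx, dy],
     [dy, dz, dx, dy, dy, dz],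
     [dy, dy, dy, dx, dy, dx],
     [dz, dy, dy, dz, dx, dy]}"

lemma PAULI_subset: "PAULI \<subseteq> tuples 6 pauli_dom"
proof -
  have "a \<in> pauli_dom" for a
    by (cases a) (auto simp: pauli_dom_def)
  then show ?thesis
    by (auto simp: PAULI_def tuples_def tuple_of_list_def PiE_iff)
qed

end

theory Submission
  imports Defs "HOL-Library.Z2"
begin

text \<open>Let \<open>t\<^sub>1, \<dots>, t\<^sub>5\<close> be the five tuples. In an Abelian group
  \<open>t\<^sub>1 t\<^sub>2\<inverse> t\<^sub>3 t\<^sub>4\<inverse> t\<^sub>5\<close> is the constant tuple \<open>(z, \<dots>, z)\<close>; every coset containing the
  five tuples contains this product, although the constant tuple is not in the relation.

  In the quaternion group, with \<open>x, y, z\<close> sent to \<open>1, i, j\<close>, that product is \<open>(z, \<dots>, z)\<close> only up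
  to an odd number of signs. Commutators and squares of the elements \<open>t\<^sub>1\<inverse> t\<^sub>k\<close> have an even
  number of entries \<open>-1\<close>, so in the subgroup they generate the parity of the signs is determined
  by the image modulo \<open>{1, -1}\<close>. This parity excludes the constant tuple, and the
  image modulo signs excludes all other tuples outside the relation.\<close>

section \<open>Powers of a group and the Mal'tsev operation on cosets\<close>

lemma group_power_group:
  "group G \<Longrightarrow> group (power_group G r)"
  by (simp add: power_group_def)

lemma carrier_power_group [simp]:
  "carrier (power_group G r) = ({..<r} \<rightarrow>\<^sub>E carrier G)"
  by (simp add: power_group_def)

lemma mult_power_group:
  "a \<otimes>\<^bsub>power_group G r\<^esub> b = (\<lambda>i\<in>{..<r}. a i \<otimes>\<^bsub>G\<^esub> b i)"
  by (simp add: power_group_def)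

lemma inv_power_group:
  assumes "group G" "a \<in> {..<r} \<rightarrow>\<^sub>E carrier G"
  shows "inv\<^bsub>power_group G r\<^esub> a = (\<lambda>i\<in>{..<r}. inv\<^bsub>G\<^esub> (a i))"
  using assms by (simp add: power_group_def)

lemma (in group) mem_lcoset_iff:
  assumes "subgroup H G" "a \<in> carrier G" "x \<in> carrier G"
  shows "x \<in> a <# H \<longleftrightarrow> inv a \<otimes> x \<in> H"
proof
  assume "x \<in> a <# H"
  then show "inv a \<otimes> x \<in> H"
    using assms subgroup.mem_carrier[OF assms(1)] by (auto simp: l_coset_def simp flip: m_assoc)
next
  assume "inv a \<otimes> x \<in> H"
  moreover have "x = a \<otimes> (inv a \<otimes> x)"
    using assms by (simp flip: m_assoc)
  ultimately show "x \<in> a <# H"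
    unfolding l_coset_def by blast
qed

text \<open>The inner representatives cancel: (g h)(g k)^-1 (g l) = g (h k^-1 l). For a right coset
  the same happens with g on the other side.\<close>

lemma (in group) lcoset_maltsev_closed:
  assumes "subgroup H G" "C \<in> lcosets H" "a \<in> C" "b \<in> C" "c \<in> C"
  shows "a \<otimes> inv b \<otimes> c \<in> C"
proof -
  interpret H: subgroup H G by fact
  obtain g where g: "g \<in> carrier G" "C = g <# H"
    using assms(2) by (auto simp: LCOSETS_def)
  obtain h k l where h: "h \<in> H" "k \<in> H" "l \<in> H" and
    eq: "a = g \<otimes> h" "b = g \<otimes> k" "c = g \<otimes> l"
    using assms g by (auto simp: l_coset_def)
  have "a \<otimes> inv b \<otimes> c = g \<otimes> (h \<otimes> inv k \<otimes> l)"
    using g h by (simp add: eq m_assoc inv_mult_group inv_solve_left' flip: m_assoc[of "inv g" g])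
  then show ?thesis
    using g h by (auto simp: l_coset_def)
qed

lemma (in group) rcoset_maltsev_closed:
  assumes "subgroup H G" "C \<in> rcosets H" "a \<in> C" "b \<in> C" "c \<in> C"
  shows "a \<otimes> inv b \<otimes> c \<in> C"
proof -
  interpret H: subgroup H G by fact
  obtain g where g: "g \<in> carrier G" "C = H #> g"
    using assms(2) by (auto simp: RCOSETS_def)
  obtain h k l where h: "h \<in> H" "k \<in> H" "l \<in> H" and
    eq: "a = h \<otimes> g" "b = k \<otimes> g" "c = l \<otimes> g"
    using assms g by (auto simp: r_coset_def)
  have "a \<otimes> inv b \<otimes> c = (h \<otimes> inv k \<otimes> l) \<otimes> g"
    using g h by (simp add: eq m_assoc inv_mult_group flip: m_assoc[of g "inv g"])
  then show ?thesis
    using g h by (auto simp: r_coset_def)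
qed

lemma (in group) maltsev_on_carrier:
  "maltsev_on (carrier G) (\<lambda>a b c. a \<otimes> inv b \<otimes> c)"
  by (simp add: maltsev_on_def m_assoc)

text \<open>Distils what both halves of the theorem use of an embedding: the coset enters only
  through its closure under a b^-1 c, which holds for left and right cosets alike.\<close>

lemma group_embedding_preserved:
  fixes G (structure)
  assumes "group G" "group_embedding D r P G"
  obtains \<sigma> C where "\<sigma> \<in> D \<rightarrow> carrier G" "inj_on \<sigma> D" "C \<subseteq> tuples r (carrier G)"
    "C \<inter> tuples r (\<sigma> ` D) = compose {..<r} \<sigma> ` P"
    "preserves (\<lambda>a b c. a \<otimes> inv b \<otimes> c) r C"
proof -
  let ?P = "power_group G r"
  obtain \<sigma> H C where \<sigma>: "\<sigma> \<in> D \<rightarrow> carrier G" "inj_on \<sigma> D"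
    and H: "subgroup H ?P"
    and C: "C \<in> (lcosets\<^bsub>?P\<^esub> H) \<union> (rcosets\<^bsub>?P\<^esub> H)"
    and eq: "C \<inter> tuples r (\<sigma> ` D) = compose {..<r} \<sigma> ` P"
    using assms(2) by (auto simp: group_embedding_def)
  interpret P: group ?P
    by (rule group_power_group) fact
  have sub: "C \<subseteq> carrier ?P"
    using C P.l_coset_subset_G[OF subgroup.subset[OF H]] P.r_coset_subset_G[OF subgroup.subset[OF H]]
    unfolding LCOSETS_def RCOSETS_def by blast
  have "(\<lambda>i\<in>{..<r}. s i \<otimes> inv (t i) \<otimes> u i) \<in> C" if "s \<in> C" "t \<in> C" "u \<in> C" for s t u
  proof -
    have "s \<otimes>\<^bsub>?P\<^esub> inv\<^bsub>?P\<^esub> t \<otimes>\<^bsub>?P\<^esub> u \<in> C"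
      using C H that P.lcoset_maltsev_closed P.rcoset_maltsev_closed by blast
    moreover have "t \<in> {..<r} \<rightarrow>\<^sub>E carrier G"
      using that sub by auto
    ultimately show ?thesis
      by (simp add: inv_power_group[OF assms(1)] mult_power_group restrict_def cong: if_cong)
  qed
  then show ?thesis
    using that[OF \<sigma> _ eq] sub by (simp add: preserves_def tuples_def)
qed

lemma group_embedding_imp_maltsev_embedding:
  assumes "group G" "group_embedding D r P G"
  shows "maltsev_embedding D r P (carrier G)"
  using group_embedding_preserved[OF assms] group.maltsev_on_carrier[OF assms(1)]
  unfolding maltsev_embedding_def by metis

section \<open>Tuples over the image of a map, and tuples of length six\<close>

lemma tuples_image:
  "tuples r (\<sigma> ` D) = compose {..<r} \<sigma> ` tuples r D"
proof (intro subset_antisym subsetI)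
  fix t assume t: "t \<in> tuples r (\<sigma> ` D)"
  define u where "u = (\<lambda>i\<in>{..<r}. inv_into D \<sigma> (t i))"
  have "u \<in> tuples r D"
    using t by (auto simp: u_def tuples_def PiE_iff intro: inv_into_into)
  moreover have "t = compose {..<r} \<sigma> u"
  proof (rule extensionalityI)
    show "t \<in> extensional {..<r}"
      using t by (simp add: tuples_def PiE_iff)
    show "t i = compose {..<r} \<sigma> u i" if "i \<in> {..<r}" for i
      using t that by (simp add: u_def tuples_def PiE_iff compose_eq f_inv_into_f)
  qed simp
  ultimately show "t \<in> compose {..<r} \<sigma> ` tuples r D"
    by blast
qed (auto simp: tuples_def PiE_iff compose_def)

lemma less_6_cases:
  "i < 6 \<Longrightarrow> i = 0 \<or> i = 1 \<or> i = 2 \<or> i = 3 \<or> i = 4 \<or> i = (5::nat)"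
  by linarith

text \<open>Turns membership in \<open>PAULI\<close> into equations between letters, ready for case
  analysis.\<close>

lemma tuple_of_list_6_eq_iff:
  assumes "u \<in> tuples 6 D"
  shows "u = tuple_of_list [a, b, c, d, e, f] \<longleftrightarrow>
    u 0 = a \<and> u 1 = b \<and> u 2 = c \<and> u 3 = d \<and> u 4 = e \<and> u 5 = f" (is "_ = ?R")
proof
  assume ?R
  show "u = tuple_of_list [a, b, c, d, e, f]"
  proof (rule extensionalityI)
    show "u \<in> extensional {..<6}"
      using assms by (simp add: tuples_def PiE_iff)
    show "u i = tuple_of_list [a, b, c, d, e, f] i" if "i \<in> {..<6}" for i
      using that \<open>?R\<close> less_6_cases[of i] by (auto simp: tuple_of_list_def)
  qed (simp add: tuple_of_list_def extensional_def)
qed (simp add: tuple_of_list_def)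

section \<open>Impossibility in Abelian groups\<close>

lemma not_abelian_group_embedding_PAULI:
  fixes G (structure)
  assumes "comm_group G"
  shows "\<not> group_embedding pauli_dom 6 PAULI G"
proof
  interpret comm_group G by fact
  assume "group_embedding pauli_dom 6 PAULI G"
  then obtain \<sigma> C where \<sigma>: "\<sigma> \<in> pauli_dom \<rightarrow> carrier G" "inj_on \<sigma> pauli_dom"
    and eq: "C \<inter> tuples 6 (\<sigma> ` pauli_dom) = compose {..<6} \<sigma> ` PAULI"
    and pres: "preserves (\<lambda>a b c. a \<otimes> inv b \<otimes> c) 6 C"
    using group_embedding_preserved[OF is_group] by metis
  have [simp]: "\<sigma> a \<in> carrier G" for a
    using \<sigma>(1) by (cases a) (auto simp: pauli_dom_def)
  have inj: "\<sigma> a = \<sigma> b \<longleftrightarrow> a = b" for a b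
    using \<sigma>(2) by (cases a; cases b) (auto simp: pauli_dom_def inj_on_def)
  define T where "T xs = compose {..<6} \<sigma> (tuple_of_list xs)" for xs
  have T: "T xs \<in> C" if "tuple_of_list xs \<in> PAULI" for xs
    using eq that by (auto simp: T_def)
  define m where "m s t u = (\<lambda>i\<in>{..<6::nat}. s i \<otimes> inv (t i) \<otimes> u i)" for s t u :: "nat \<Rightarrow> 'a"
  have m: "m s t u \<in> C" if "s \<in> C" "t \<in> C" "u \<in> C" for s t u
    using pres that by (simp add: m_def preserves_def)
  \<comment> \<open>The alternating product of the five tuples, written as two nested Mal'tsev
    operations so that it stays in \<open>C\<close>.\<close>
  define w where "w = m (m (T [dx, dx, dz, dx, dz, dx]) (T [dx, dx, dx, dy, dx, dy])
      (T [dy, dz, dx, dy, dy, dz])) (T [dy, dy, dy, dx, dy, dx]) (T [dz, dy, dy, dz, dx, dy])"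
  have "w \<in> C"
    unfolding w_def by (intro m T) (simp_all add: PAULI_def)
  have cancel: "a \<otimes> (inv a \<otimes> b) = b" "a \<otimes> (b \<otimes> inv a) = b" "inv a \<otimes> (a \<otimes> b) = b"
    if "a \<in> carrier G" "b \<in> carrier G" for a b
    using that m_lcomm[of a b "inv a"] by (simp_all flip: m_assoc)
  \<comment> \<open>A product of three letters and the inverses of two of them: in every coordinate
    of \<open>w\<close>, each letter occurs once, and \<open>dx\<close> and \<open>dy\<close> once
    more inverted.\<close>
  have cancel2: "a \<otimes> (b \<otimes> (c \<otimes> (inv a \<otimes> inv b))) = c"
    if "a \<in> carrier G" "b \<in> carrier G" "c \<in> carrier G" for a b c
    using that cancel(2)[of "a \<otimes> b" c] by (simp add: m_assoc inv_mult)
  have w: "w i = \<sigma> dz" if "i < 6" for i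
    using less_6_cases[OF that]
    by (elim disjE) (simp_all add: w_def m_def T_def compose_def tuple_of_list_def
        m_ac cancel cancel2)
  have "w \<in> tuples 6 (\<sigma> ` pauli_dom)"
    using w by (auto simp: tuples_def PiE_iff pauli_dom_def w_def m_def)
  then obtain u where u: "u \<in> PAULI" "w = compose {..<6} \<sigma> u"
    using eq \<open>w \<in> C\<close> by blast
  have "u i = dz" if "i < 6" for i
    using u(2) w[OF that] that by (simp add: compose_def inj)
  \<comment> \<open>Two coordinates suffice: the only tuple of \<open>PAULI\<close> starting with
    \<open>dz\<close> continues with \<open>dy\<close>.\<close>
  then have "u 0 = dz" "u 1 = dz"
    by simp_all
  then show False
    using u(1) by (auto simp: PAULI_def tuple_of_list_def)
qed


section \<open>The quaternion group on three-bit codes\<close>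

text \<open>A bit triple \<open>(p, q, s)\<close> codes the element \<open>(-1)\<^sup>s j\<^sup>q i\<^sup>p\<close> of the quaternion group.\<close>

definition q8_code :: "bit \<Rightarrow> bit \<Rightarrow> bit \<Rightarrow> nat"
  where "q8_code p q s = of_bit p + 2 * of_bit q + 4 * of_bit s"

definition q8_p :: "nat \<Rightarrow> bit"
  where "q8_p n = of_bool (odd n)"

definition q8_q :: "nat \<Rightarrow> bit"
  where "q8_q n = of_bool (odd (n div 2))"

definition q8_s :: "nat \<Rightarrow> bit"
  where "q8_s n = of_bool (odd (n div 4))"

lemma q8_code_less [simp]: "q8_code p q s < 8"
  by (cases p; cases q; cases s) (simp_all add: q8_code_def)

lemma q8_bits_code [simp]:
  "q8_p (q8_code p q s) = p" "q8_q (q8_code p q s) = q" "q8_s (q8_code p q s) = s"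
  by (cases p; cases q; cases s; simp add: q8_code_def q8_p_def q8_q_def q8_s_def)+

lemma q8_code_bits:
  assumes "n < 8"
  shows "q8_code (q8_p n) (q8_q n) (q8_s n) = n"
proof -
  have "n \<in> {0, 1, 2, 3, 4, 5, 6, 7}"
    using assms by auto
  then show ?thesis
    by (auto simp: q8_code_def q8_p_def q8_q_def q8_s_def)
qed

text \<open>The three products in the sign bit come from i^2 = -1, from moving i past j (ij = -ji),
  and from j^2 = -1, in this order.\<close>

definition Q8 :: "nat monoid"
  where "Q8 = \<lparr>carrier = {..<8},
    monoid.mult = (\<lambda>m n. q8_code (q8_p m + q8_p n) (q8_q m + q8_q n)
      (q8_s m + q8_s n + q8_p m * q8_p n + q8_p m * q8_q n + q8_q m * q8_q n)),
    one = q8_code 0 0 0\<rparr>"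

lemma carrier_Q8 [simp]: "carrier Q8 = {..<8}"
  by (simp add: Q8_def)

lemma bit_add_self: "a + a = 0" "a + (a + b) = b" for a b :: bit
  by (cases a; cases b; simp)+

lemma bit_add_eq_iff: "a + b = c \<longleftrightarrow> a = b + (c::bit)"
  by (cases a; cases b; cases c; simp)

lemma bit_mult_self: "a * a = (a::bit)" "a * (a * b) = (a * b::bit)"
  by (cases a; simp)+

declare add_bit_eq_xor [simp del] mult_bit_eq_and [simp del]

text \<open>Normalises polynomials over the two-element field. Rewriting sums to xor and products to
  conjunction is switched off so that the ring laws apply.\<close>

lemmas bit_ring = algebra_simps bit_add_self bit_mult_self

lemma q8_mult [simp]:
  "q8_p (a \<otimes>\<^bsub>Q8\<^esub> b) = q8_p a + q8_p b"
  "q8_q (a \<otimes>\<^bsub>Q8\<^esub> b) = q8_q a + q8_q b"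
  "q8_s (a \<otimes>\<^bsub>Q8\<^esub> b) = q8_s a + q8_s b + q8_p a * q8_p b + q8_p a * q8_q b + q8_q a * q8_q b"
  by (simp_all add: Q8_def)

lemma q8_one [simp]: "q8_p \<one>\<^bsub>Q8\<^esub> = 0" "q8_q \<one>\<^bsub>Q8\<^esub> = 0" "q8_s \<one>\<^bsub>Q8\<^esub> = 0"
  by (simp_all add: Q8_def)

lemma q8_eqI:
  "\<lbrakk>m < 8; n < 8; q8_p m = q8_p n; q8_q m = q8_q n; q8_s m = q8_s n\<rbrakk> \<Longrightarrow> m = n"
  by (metis q8_code_bits)

lemma q8_closed [simp]: "a \<otimes>\<^bsub>Q8\<^esub> b < 8" "\<one>\<^bsub>Q8\<^esub> < 8"
  by (simp_all add: Q8_def)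

lemma group_Q8: "group Q8"
proof (rule groupI)
  fix a assume "a \<in> carrier Q8"
  \<comment> \<open>The inverse of j^q i^p is (-i)^p (-j)^q = (-1)^(p+q+pq) j^q i^p; a central sign
    is its own inverse.\<close>
  let ?b = "q8_code (q8_p a) (q8_q a) (q8_s a + q8_p a + q8_p a * q8_q a + q8_q a)"
  have "?b \<otimes>\<^bsub>Q8\<^esub> a = \<one>\<^bsub>Q8\<^esub>"
    by (rule q8_eqI) (simp_all add: bit_ring)
  then show "\<exists>b\<in>carrier Q8. b \<otimes>\<^bsub>Q8\<^esub> a = \<one>\<^bsub>Q8\<^esub>"
    by (rule bexI) (simp only: carrier_Q8 lessThan_iff q8_code_less)
qed (auto intro!: q8_eqI simp: bit_ring)

lemma q8_inv [simp]:
  assumes "a < 8"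
  shows "q8_p (inv\<^bsub>Q8\<^esub> a) = q8_p a" "q8_q (inv\<^bsub>Q8\<^esub> a) = q8_q a"
    "q8_s (inv\<^bsub>Q8\<^esub> a) = q8_s a + q8_p a + q8_p a * q8_q a + q8_q a"
proof -
  let ?b = "q8_code (q8_p a) (q8_q a) (q8_s a + q8_p a + q8_p a * q8_q a + q8_q a)"
  have "?b \<otimes>\<^bsub>Q8\<^esub> a = \<one>\<^bsub>Q8\<^esub>"
    by (rule q8_eqI) (simp_all add: bit_ring)
  then have "inv\<^bsub>Q8\<^esub> a = ?b"
    by (rule group.inv_equality[OF group_Q8]) (use assms in simp_all)
  then show "q8_p (inv\<^bsub>Q8\<^esub> a) = q8_p a" "q8_q (inv\<^bsub>Q8\<^esub> a) = q8_q a"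
    "q8_s (inv\<^bsub>Q8\<^esub> a) = q8_s a + q8_p a + q8_p a * q8_q a + q8_q a"
    by simp_all
qed

lemma not_comm_Q8: "\<not> comm_group Q8"
proof
  assume "comm_group Q8"
  \<comment> \<open>The two codes are i and j, and ij = -ji shows in the sign bit.\<close>
  then have "q8_code 1 0 0 \<otimes>\<^bsub>Q8\<^esub> q8_code 0 1 0 = q8_code 0 1 0 \<otimes>\<^bsub>Q8\<^esub> q8_code 1 0 0"
    by (simp add: comm_groupE(4))
  then have "q8_s (q8_code 1 0 0 \<otimes>\<^bsub>Q8\<^esub> q8_code 0 1 0) = q8_s (q8_code 0 1 0 \<otimes>\<^bsub>Q8\<^esub> q8_code 1 0 0)"
    by (rule arg_cong)
  then show False
    by simp
qed

section \<open>The subgroup of the sixth power and the embedding\<close>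

text \<open>The subgroup generated by the \<open>t\<^sub>1\<inverse> t\<^sub>k\<close> and by the sign vectors with an even number of
  entries \<open>-1\<close>. The linear equations cut out its image modulo signs; the last equation fixes
  the parity of the signs, which is a quadratic form on that image.\<close>

definition pauli_subgroup :: "(nat \<Rightarrow> nat) set"
  where "pauli_subgroup = {h \<in> {..<6} \<rightarrow>\<^sub>E {..<8}.
    q8_q (h 3) = q8_q (h 0) \<and> q8_q (h 5) = q8_q (h 1) \<and> q8_q (h 4) = q8_q (h 2) \<and>
    q8_p (h 4) = q8_p (h 0) \<and>
    q8_p (h 1) = q8_p (h 0) + q8_q (h 0) + q8_q (h 1) \<and>
    q8_p (h 2) = q8_p (h 0) + q8_q (h 0) + q8_q (h 1) \<and>
    q8_p (h 3) = q8_p (h 0) + q8_q (h 0) + q8_q (h 1) + q8_q (h 2) \<and>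
    q8_p (h 5) = q8_p (h 0) + q8_q (h 2) \<and>
    q8_s (h 0) + q8_s (h 1) + q8_s (h 2) + q8_s (h 3) + q8_s (h 4) + q8_s (h 5)
      = q8_p (h 0) * (q8_q (h 0) + q8_q (h 1)) + q8_q (h 1)}"

text \<open>The parity equation solved for one sign, so that it can serve as a rewrite rule
  eliminating \<open>q8_s (h 0)\<close>.\<close>

lemma pauli_subgroup_sign:
  assumes "h \<in> pauli_subgroup"
  shows "q8_s (h 0) = q8_s (h 1) + q8_s (h 2) + q8_s (h 3) + q8_s (h 4) + q8_s (h 5)
    + q8_p (h 0) * (q8_q (h 0) + q8_q (h 1)) + q8_q (h 1)"
proof -
  have "q8_s (h 0) + (q8_s (h 1) + (q8_s (h 2) + (q8_s (h 3) + (q8_s (h 4) + q8_s (h 5)))))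
      = q8_p (h 0) * (q8_q (h 0) + q8_q (h 1)) + q8_q (h 1)"
    using assms by (simp add: pauli_subgroup_def add.assoc)
  then show ?thesis
    unfolding bit_add_eq_iff by (simp only: add.assoc)
qed

text \<open>The linear conditions are additive. Under them, the sign corrections of a product,
  summed over the six coordinates, give the polar form of the quadratic form in the parity
  condition; those of an inverse sum to 0.\<close>

lemma subgroup_pauli_subgroup: "subgroup pauli_subgroup (power_group Q8 6)"
proof (rule group.subgroupI)
  show "group (power_group Q8 6)"
    by (rule group_power_group) (rule group_Q8)
  show "pauli_subgroup \<subseteq> carrier (power_group Q8 6)"
    by (auto simp: pauli_subgroup_def)
  have "(\<lambda>i\<in>{..<6}. \<one>\<^bsub>Q8\<^esub>) \<in> pauli_subgroup"
    by (simp add: pauli_subgroup_def)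
  then show "pauli_subgroup \<noteq> {}"
    by blast
next
  fix a assume a: "a \<in> pauli_subgroup"
  then have [simp]: "a i < 8" if "i < 6" for i
    using that by (auto simp: pauli_subgroup_def)
  have inv: "inv\<^bsub>power_group Q8 6\<^esub> a = (\<lambda>i\<in>{..<6}. inv\<^bsub>Q8\<^esub> (a i))"
    using a by (simp add: inv_power_group[OF group_Q8] pauli_subgroup_def)
  have "inv\<^bsub>Q8\<^esub> (a i) < 8" if "i < 6" for i
    using group.inv_closed[OF group_Q8, of "a i"] that by simp
  then show "inv\<^bsub>power_group Q8 6\<^esub> a \<in> pauli_subgroup"
    using a pauli_subgroup_sign[OF a] unfolding inv
    by (simp add: pauli_subgroup_def bit_ring)
next
  fix a b assume a: "a \<in> pauli_subgroup" and b: "b \<in> pauli_subgroup"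
  show "a \<otimes>\<^bsub>power_group Q8 6\<^esub> b \<in> pauli_subgroup"
    using a b pauli_subgroup_sign[OF a] pauli_subgroup_sign[OF b] unfolding mult_power_group
    by (simp add: pauli_subgroup_def bit_ring)
qed

fun q8_letter :: "letter \<Rightarrow> nat"
  where
    "q8_letter dx = q8_code 0 0 0"
  | "q8_letter dy = q8_code 1 0 0"
  | "q8_letter dz = q8_code 0 1 0"

lemma group_embedding_Q8: "group_embedding pauli_dom 6 PAULI Q8"
proof -
  let ?G = "power_group Q8 6" and ?\<sigma> = "compose {..<6} q8_letter"
  interpret G: group ?G
    by (rule group_power_group) (rule group_Q8)
  have [simp]: "q8_letter a < 8" for a
    by (cases a) simp_all
  \<comment> \<open>Any tuple of \<open>PAULI\<close> could represent the coset; this is the first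
    one.\<close>
  define t where "t = tuple_of_list [dx, dx, dz, dx, dz, dx]"
  have \<sigma>: "?\<sigma> u \<in> carrier ?G" for u
    by (simp add: compose_def)
  define C where "C = ?\<sigma> t <#\<^bsub>?G\<^esub> pauli_subgroup"
  have C: "C \<in> lcosets\<^bsub>?G\<^esub> pauli_subgroup"
    using \<sigma> by (auto simp: LCOSETS_def C_def)
  have "inv\<^bsub>?G\<^esub> ?\<sigma> t \<otimes>\<^bsub>?G\<^esub> ?\<sigma> u = (\<lambda>i\<in>{..<6}. inv\<^bsub>Q8\<^esub> (q8_letter (t i)) \<otimes>\<^bsub>Q8\<^esub> q8_letter (u i))" for u
    using \<sigma>[of t] by (auto simp: inv_power_group[OF group_Q8] mult_power_group compose_def)
  then have iff: "?\<sigma> u \<in> C \<longleftrightarrow>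
      (\<lambda>i\<in>{..<6}. inv\<^bsub>Q8\<^esub> (q8_letter (t i)) \<otimes>\<^bsub>Q8\<^esub> q8_letter (u i)) \<in> pauli_subgroup"
    for u
    unfolding C_def by (simp only: G.mem_lcoset_iff[OF subgroup_pauli_subgroup \<sigma> \<sigma>])
  have t: "t 0 = dx" "t (Suc 0) = dx" "t 2 = dz" "t 3 = dx" "t 4 = dz" "t 5 = dx"
    by (simp_all add: t_def tuple_of_list_def)
  \<comment> \<open>Of all 3^6 tuples exactly the five of \<open>PAULI\<close> survive. Splitting in
    the order 0, 3, 4, 2, 1, 5 lets the linear conditions discard most branches early.\<close>
  have "?\<sigma> u \<in> C \<longleftrightarrow> u \<in> PAULI" if "u \<in> tuples 6 pauli_dom" for u
    unfolding iff using that
    by (simp add: pauli_subgroup_def PAULI_def tuple_of_list_6_eq_iff t del: q8_letter.simps)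
      (cases "u 0"; cases "u 3"; simp; cases "u 4"; simp; cases "u 2"; simp;
        cases "u (Suc 0)"; simp; cases "u 5"; simp)
  then have "C \<inter> tuples 6 (q8_letter ` pauli_dom) = ?\<sigma> ` PAULI"
    using PAULI_subset unfolding tuples_image by blast
  moreover have "inj_on q8_letter pauli_dom"
    by (auto simp: inj_on_def pauli_dom_def q8_code_def)
  ultimately show ?thesis
    unfolding group_embedding_def using C subgroup_pauli_subgroup
    by (intro exI[of _ q8_letter] exI[of _ pauli_subgroup] exI[of _ C]) simp
qed

theorem theorem1p3:
  shows "(\<exists>G :: nat monoid. group G \<and> finite (carrier G) \<and> \<not> comm_group G \<and>
            group_embedding pauli_dom 6 PAULI G)
       \<and> (\<exists>E :: nat set. maltsev_embedding pauli_dom 6 PAULI E)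
       \<and> (\<forall>A :: ('g, 'm) monoid_scheme. comm_group A \<longrightarrow>
            \<not> group_embedding pauli_dom 6 PAULI A)"
proof (intro conjI)
  show "\<exists>G :: nat monoid. group G \<and> finite (carrier G) \<and> \<not> comm_group G \<and>
      group_embedding pauli_dom 6 PAULI G"
    using group_Q8 not_comm_Q8 group_embedding_Q8 by (intro exI[of _ Q8]) simp
  show "\<exists>E :: nat set. maltsev_embedding pauli_dom 6 PAULI E"
    using group_embedding_imp_maltsev_embedding[OF group_Q8 group_embedding_Q8] by blast
qed (use not_abelian_group_embedding_PAULI in blast)

end
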